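(* Let $p\ge0$, $q\ge0$, $m\ge0$ be integers and let $f,g,h$ be entire functions represented by vector valued Dirichlet series such that $f$ has relative index-pair $(m,q)$ and $g$ has relative index-pair $(m,p)$ with respect to $h$. Then $$\max\left\{\left[\frac{\overline{\Delta}_h^{(m,q)}(f)}{\tau_h^{(m,p)}(g)}\right]^{\frac{1}{\lambda_h^{(m,p)}(g)}},\left[\frac{\Delta_h^{(m,q)}(f)}{\overline{\tau}_h^{(m,p)}(g)}\right]^{\frac{1}{\lambda_h^{(m,p)}(g)}}\right\}\le\Delta_g^{(p,q)}(f)\le\left[\frac{\Delta_h^{(m,q)}(f)}{\overline{\Delta}_h^{(m,p)}(g)}\right]^{\frac{1}{\rho_h^{(m,p)}(g)}}.$$
   Context: VVDS: an entire function represented by a vector valued Dirichlet series is a function $f(s)=\sum_{n\ge1}a_ne^{s\lambda_n}$, $s=\sigma+it$, not identically zero, with $a_n$ in a complex Banach space $(E,\|\cdot\|)$, $0<\lambda_n<\lambda_{n+1}$, $\lambda_n\to+\infty$, $\limsup_{n}\frac{\log n}{\lambda_n}<+\infty$ and $\limsup_{n}\frac{\log\|a_n\|}{\lambda_n}=-\infty$ (so the series converges absolutely everywhere). Its maximum modulus is $M_f(\sigma)=\sup_{t\in\mathbb R}\|f(\sigma+it)\|$, and $M_f^{-1}$ is the inverse function of $M_f$. Iterated logarithms: $\log^{[0]}x=x$, $\log^{[-1]}x=\exp x$, $\log^{[k]}x=\log(\log^{[k-1]}x)$ for $k\ge1$. Index-pair: for $k\ge q+1\ge1$ let $\rho_f(k,q)=\limsup_{\sigma\to+\infty}\frac{\log^{[k]}M_f(\sigma)}{\log^{[q]}\sigma}$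 (the same formula is used for shifted indices). $f$ has index-pair $(1,1)$ if $0<\rho_f(1,1)<\infty$; otherwise $f$ has index-pair $(k,q)\neq(1,1)$, $k\ge q+1\ge1$, if $\delta_{k-q,0}<\rho_f(k,q)<\infty$ and $\rho_f(k-1,q-1)$ is not a positive real number, where $\delta_{i,j}=1$ if $i=j$ and $0$ otherwise. Relative Ritt orders: if $f$ and $g$ have index-pairs $(k,q)$ and $(k,p)$ with $k\ge q+1\ge1$, $k\ge p+1\ge1$, then $$\rho_g^{(p,q)}(f)=\limsup_{\sigma\to+\infty}\frac{\log^{[p]}M_g^{-1}(M_f(\sigma))}{\log^{[q]}\sigma},\qquad \lambda_g^{(p,q)}(f)=\liminf_{\sigma\to+\infty}\frac{\log^{[p]}M_g^{-1}(M_f(\sigma))}{\log^{[q]}\sigma}$$ are the $(p,q)$-th relative Ritt order and lower order of $f$ with respect to $g$. In this situation $f$ has relative index-pair $(p,q)$ with respect to $g$ if $b<\rho_g^{(p,q)}(f)<\infty$ and $\rho_g^{(p-1,q-1)}(f)$ (same formula) is not a nonzero finite number, where $b=1$ if $p=q=k$ and $b=0$ otherwise. Relative types: if $0<\rho_g^{(p,q)}(f)<\infty$, the relative Ritt type $\Delta_g^{(p,q)}(f)$ and lower type $\overline{\Delta}_g^{(p,q)}(f)$ are respectively the $\limsup$ and the $\liminf$ as $\sigma\to+\infty$ of $$\frac{\log^{[p-1]}M_g^{-1}(M_f(\sigma))}{[\log^{[q-1]}\sigma]^{\rho_g^{(p,q)}(f)}}.$$ If $0<\lambda_g^{(p,q)}(f)<\infty$,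 the relative Ritt weak type $\tau_g^{(p,q)}(f)$ and the indicator $\overline{\tau}_g^{(p,q)}(f)$ are respectively the $\liminf$ and the $\limsup$ as $\sigma\to+\infty$ of $$\frac{\log^{[p-1]}M_g^{-1}(M_f(\sigma))}{[\log^{[q-1]}\sigma]^{\lambda_g^{(p,q)}(f)}}.$$ For other pairs of functions and indices the definitions are the same with the letters changed. The claim presupposes that all quantities appearing in it are defined, i.e. the corresponding orders or lower orders are positive and finite. Convention: types lie in $[0,\infty]$; quotients are taken with $a/0=\infty$ for $a>0$ and $a/\infty=0$ for $a<\infty$, and relations are asserted when every quotient is meaningful (no $0/0$ or $\infty/\infty$). *)

theory Defs
  imports "HOL-Analysis.Analysis"
begin

class complex_banach = banach +
  fixes scaleC :: "complex \<Rightarrow> 'a \<Rightarrow> 'a" (infixr "*\<^sub>C" 75)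
  assumes scaleC_add_right: "c *\<^sub>C (x + y) = c *\<^sub>C x + c *\<^sub>C y"
    and scaleC_add_left: "(c + d) *\<^sub>C x = c *\<^sub>C x + d *\<^sub>C x"
    and scaleC_scaleC: "c *\<^sub>C d *\<^sub>C x = (c * d) *\<^sub>C x"
    and scaleC_of_real: "complex_of_real r *\<^sub>C x = r *\<^sub>R x"
    and norm_scaleC: "norm (c *\<^sub>C x) = cmod c * norm x"

instantiation complex :: complex_banach
begin

definition scaleC_complex_def: "c *\<^sub>C (x::complex) = c * x"

instance
  by standard (simp_all add: scaleC_complex_def algebra_simps norm_mult scaleR_conv_of_real)

end

(* The sequences are indexed from 1, so the values a 0 and l 0 are irrelevant.
   The logarithm of a zero coefficient is -\<infinity>. *)
definition vvds_coeffs :: "(nat \<Rightarrow> 'a::complex_banach) \<Rightarrow> (nat \<Rightarrow> real) \<Rightarrow> bool" where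
  "vvds_coeffs a l \<longleftrightarrow>
     (\<forall>n\<ge>1. 0 < l n \<and> l n < l (Suc n)) \<and>
     filterlim l at_top sequentially \<and>
     limsup (\<lambda>n. ereal (ln (real n) / l n)) < \<infinity> \<and>
     limsup (\<lambda>n. if a n = 0 then -\<infinity> else ereal (ln (norm (a n)) / l n)) = -\<infinity>"

definition entire_vvds :: "(complex \<Rightarrow> 'a::complex_banach) \<Rightarrow> bool" where
  "entire_vvds f \<longleftrightarrow>
     (\<exists>a l. vvds_coeffs a l \<and>
        (\<forall>s. (\<lambda>n. exp (s * complex_of_real (l (Suc n))) *\<^sub>C a (Suc n)) sums f s)) \<and>
     (\<exists>s. f s \<noteq> 0)"

definition max_modulus :: "(complex \<Rightarrow> 'a::complex_banach) \<Rightarrow> real \<Rightarrow> real" where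
  "max_modulus f \<sigma> = (SUP t. norm (f (Complex \<sigma> t)))"

(* For an entire vvds f, max_modulus f is a bijection from the reals onto {0<..}, so this is
   the true inverse at every value of a maximum modulus. *)
definition inv_max_modulus :: "(complex \<Rightarrow> 'a::complex_banach) \<Rightarrow> real \<Rightarrow> real" where
  "inv_max_modulus f = inv (max_modulus f)"

(* Only the superscripts k \<ge> -1 are used, and iter_log (-1) = exp. *)
definition iter_log :: "int \<Rightarrow> real \<Rightarrow> real" where
  "iter_log k x = (if 0 \<le> k then (ln ^^ nat k) x else (exp ^^ nat (- k)) x)"

definition ritt_order :: "int \<Rightarrow> int \<Rightarrow> (complex \<Rightarrow> 'a::complex_banach) \<Rightarrow> ereal" where
  "ritt_order k q f =
     Limsup at_top (\<lambda>\<sigma>. ereal (iter_log k (max_modulus f \<sigma>) / iter_log q \<sigma>))"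

definition has_index_pair :: "(complex \<Rightarrow> 'a::complex_banach) \<Rightarrow> int \<Rightarrow> int \<Rightarrow> bool" where
  "has_index_pair f k q \<longleftrightarrow>
     (let finite_11 = (0 < ritt_order 1 1 f \<and> ritt_order 1 1 f < \<infinity>) in
      if k = 1 \<and> q = 1 then finite_11
      else \<not> finite_11 \<and> k \<ge> q + 1 \<and> q + 1 \<ge> 1 \<and>
        (if k - q = 0 then 1 else 0) < ritt_order k q f \<and> ritt_order k q f < \<infinity> \<and>
        \<not> (0 < ritt_order (k - 1) (q - 1) f \<and> ritt_order (k - 1) (q - 1) f < \<infinity>))"

definition rel_growth ::
  "(complex \<Rightarrow> 'b::complex_banach) \<Rightarrow> (complex \<Rightarrow> 'a::complex_banach) \<Rightarrow> real \<Rightarrow> real" where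
  "rel_growth g f \<sigma> = inv_max_modulus g (max_modulus f \<sigma>)"

definition rel_order ::
  "(complex \<Rightarrow> 'b::complex_banach) \<Rightarrow> int \<Rightarrow> int \<Rightarrow> (complex \<Rightarrow> 'a::complex_banach) \<Rightarrow> ereal" where
  "rel_order g p q f =
     Limsup at_top (\<lambda>\<sigma>. ereal (iter_log p (rel_growth g f \<sigma>) / iter_log q \<sigma>))"

definition rel_lower_order ::
  "(complex \<Rightarrow> 'b::complex_banach) \<Rightarrow> int \<Rightarrow> int \<Rightarrow> (complex \<Rightarrow> 'a::complex_banach) \<Rightarrow> ereal" where
  "rel_lower_order g p q f =
     Liminf at_top (\<lambda>\<sigma>. ereal (iter_log p (rel_growth g f \<sigma>) / iter_log q \<sigma>))"

definition has_rel_index_pair ::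
  "(complex \<Rightarrow> 'b::complex_banach) \<Rightarrow> int \<Rightarrow> int \<Rightarrow> (complex \<Rightarrow> 'a::complex_banach) \<Rightarrow> bool" where
  "has_rel_index_pair g p q f \<longleftrightarrow>
     (\<exists>k. k \<ge> q + 1 \<and> q + 1 \<ge> 1 \<and> k \<ge> p + 1 \<and> p + 1 \<ge> 1 \<and>
        has_index_pair f k q \<and> has_index_pair g k p \<and>
        (if p = q \<and> q = k then 1 else 0) < rel_order g p q f \<and> rel_order g p q f < \<infinity>) \<and>
     \<not> (rel_order g (p - 1) (q - 1) f \<noteq> 0 \<and> \<bar>rel_order g (p - 1) (q - 1) f\<bar> \<noteq> \<infinity>)"

(* The quotient whose upper and lower limits are the types (w the relative order) and the
   weak types (w the relative lower order); w is meant to be positive and finite. *)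
definition type_ratio ::
  "(complex \<Rightarrow> 'b::complex_banach) \<Rightarrow> int \<Rightarrow> int \<Rightarrow> (complex \<Rightarrow> 'a::complex_banach) \<Rightarrow>
     ereal \<Rightarrow> real \<Rightarrow> ereal" where
  "type_ratio g p q f w \<sigma> =
     ereal (iter_log (p - 1) (rel_growth g f \<sigma>) / iter_log (q - 1) \<sigma> powr real_of_ereal w)"

definition rel_type ::
  "(complex \<Rightarrow> 'b::complex_banach) \<Rightarrow> int \<Rightarrow> int \<Rightarrow> (complex \<Rightarrow> 'a::complex_banach) \<Rightarrow> ereal" where
  "rel_type g p q f = Limsup at_top (type_ratio g p q f (rel_order g p q f))"

definition rel_lower_type ::
  "(complex \<Rightarrow> 'b::complex_banach) \<Rightarrow> int \<Rightarrow> int \<Rightarrow> (complex \<Rightarrow> 'a::complex_banach) \<Rightarrow> ereal" where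
  "rel_lower_type g p q f = Liminf at_top (type_ratio g p q f (rel_order g p q f))"

definition rel_weak_type ::
  "(complex \<Rightarrow> 'b::complex_banach) \<Rightarrow> int \<Rightarrow> int \<Rightarrow> (complex \<Rightarrow> 'a::complex_banach) \<Rightarrow> ereal" where
  "rel_weak_type g p q f = Liminf at_top (type_ratio g p q f (rel_lower_order g p q f))"

definition rel_weak_type_indicator ::
  "(complex \<Rightarrow> 'b::complex_banach) \<Rightarrow> int \<Rightarrow> int \<Rightarrow> (complex \<Rightarrow> 'a::complex_banach) \<Rightarrow> ereal" where
  "rel_weak_type_indicator g p q f =
     Limsup at_top (type_ratio g p q f (rel_lower_order g p q f))"

(* On ereal, a / 0 = \<infinity> for a > 0 and a / \<infinity> = 0 for finite a hold by definition; only the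
   two indeterminate forms have to be excluded. *)
definition quotient_meaningful :: "ereal \<Rightarrow> ereal \<Rightarrow> bool" where
  "quotient_meaningful a b \<longleftrightarrow> \<not> (a = 0 \<and> b = 0) \<and> \<not> (a = \<infinity> \<and> b = \<infinity>)"

(* For x in [0, \<infinity>] and r > 0. *)
definition ereal_powr :: "ereal \<Rightarrow> real \<Rightarrow> ereal" where
  "ereal_powr x r = (if x = \<infinity> then \<infinity> else ereal (real_of_ereal x powr r))"

end

(* The maximum modulus M_f is continuous by absolute convergence. Moreover M_f(sigma) e^(-l sigma)
   is nondecreasing, l being the least exponent, because f(s) e^(-l s) is a Poisson integral of its
   values on any vertical line to the right of s; so M_f is strictly increasing and unbounded from
   some point on. Hence x = M_g^-1(M_f(sigma)) is an asymptotically invertible change of variable,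
   and M_h^-1(M_f(sigma)) = M_h^-1(M_g(x)). All orders and types thus compare three functions U, P, Q that
   tend to infinity along one filter. The orders satisfy
   lambda_h(g) rho_g(f) <= rho_h(f) <= rho_h(g) rho_g(f), so for the exponents
   a = rho_h(f), b = rho_h(g), c = lambda_h(g), r = rho_g(f) one has
   (U / P^b) (P / Q^r)^b <= U / Q^a <= (U / P^c) (P / Q^r)^c, and limits give the claim. *)
theory Submission
  imports Defs "HOL-Complex_Analysis.Cauchy_Integral_Formula"
begin

section \<open>Complex scalar multiplication as a bounded linear map\<close>

lemma bounded_linear_scaleC_left: "bounded_linear (\<lambda>c. c *\<^sub>C (x::'a::complex_banach))"
proof (rule bounded_linear_intro[where K = "norm x"])
  fix r :: real and c :: complex
  have "(complex_of_real r * c) *\<^sub>C x = complex_of_real r *\<^sub>C (c *\<^sub>C x)"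
    by (simp only: scaleC_scaleC)
  then show "(r *\<^sub>R c) *\<^sub>C x = r *\<^sub>R (c *\<^sub>C x)"
    by (simp add: scaleC_of_real scaleR_conv_of_real)
qed (auto simp: scaleC_add_left norm_scaleC)

lemma bounded_linear_scaleC_right: "bounded_linear (\<lambda>x::'a::complex_banach. c *\<^sub>C x)"
proof (rule bounded_linear_intro[where K = "cmod c"])
  fix r :: real and x :: 'a
  show "c *\<^sub>C (r *\<^sub>R x) = r *\<^sub>R (c *\<^sub>C x)"
    by (simp only: scaleC_of_real[symmetric] scaleC_scaleC mult.commute)
qed (auto simp: scaleC_add_right norm_scaleC)

subsection \<open>A Poisson integral on vertical lines\<close>

text \<open>The Cayley transform thus maps the closed unit disc into the closed right half-plane and
  the unit circle into the imaginary axis. At \<open>w = -1\<close> both sides are 0, since division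
  by zero gives 0.\<close>

lemma Re_cayley:
  "Re ((1 - w) / (1 + w)) = (1 - (cmod w)\<^sup>2) / (cmod (1 + w))\<^sup>2"
proof -
  have *: "(cmod (1 + w))\<^sup>2 = (1 + Re w)\<^sup>2 + (Im w)\<^sup>2" "(cmod w)\<^sup>2 = (Re w)\<^sup>2 + (Im w)\<^sup>2"
    by (simp_all add: cmod_power2)
  show ?thesis
    unfolding Re_divide * by (simp add: algebra_simps power2_eq_square)
qed

text \<open>The mean value property of \<open>F\<close> holds on circles of radius below 1, where
  \<open>F\<close> is holomorphic. It passes to the unit circle by dominated convergence:
  \<open>c \<ge> 0\<close> gives \<open>cmod (F w) \<le> 1\<close> on the closed disc, and
  \<open>w = -1\<close> is the only singular point.\<close>

lemma cayley_unit_circle_has_integral: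
  fixes c :: real
  assumes "c \<ge> 0"
  defines "F \<equiv> \<lambda>w. exp (- of_real c * ((1 - w) / (1 + w)) :: complex)"
  shows "((\<lambda>x. F (exp (2 * of_real pi * \<i> * of_real x))) has_integral F 0) {0..1}"
proof -
  define E :: "real \<Rightarrow> complex" where "E x = exp (2 * of_real pi * \<i> * of_real x)" for x
  \<comment> \<open>Circles of these radii avoid the singularity at -1; the double
    \<open>Suc\<close> makes even the first radius, 1/2, positive.\<close>
  define r :: "nat \<Rightarrow> real" where "r k = 1 - inverse (real (Suc (Suc k)))" for k
  have r: "0 < r k" "r k < 1" for k
    by (auto simp: r_def field_simps)
  have r_lim: "r \<longlonglongrightarrow> 1"
  proof -
    have "(\<lambda>k. 1 + - inverse (real (Suc k))) \<longlonglongrightarrow> 1"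
      by (rule LIMSEQ_inverse_real_of_nat_add_minus)
    from LIMSEQ_Suc[OF this] show ?thesis by (simp add: r_def[abs_def])
  qed
  have E1: "cmod (E x) = 1" for x by (simp add: E_def)
  have bound: "cmod (F w) \<le> 1" if "cmod w \<le> 1" for w
  proof -
    have "0 \<le> Re ((1 - w) / (1 + w))"
      unfolding Re_cayley using that by (simp add: power_le_one)
    moreover have "Re (- of_real c * u) = - c * Re u" for u
      by simp
    ultimately have "Re (- of_real c * ((1 - w) / (1 + w))) \<le> 0"
      using assms(1) by (simp only: mult_nonneg_nonneg minus_mult_left[symmetric] neg_le_0_iff_le)
    then show ?thesis by (simp only: F_def norm_exp_eq_Re exp_le_one_iff)
  qed
  have mean: "((\<lambda>x. F (of_real (r k) * E x)) has_integral F 0) {0..1}" for k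
  proof -
    have "1 + w \<noteq> 0" if "cmod w \<le> r k" for w
    proof
      assume "1 + w = 0"
      then have "w = -1" by (simp add: eq_neg_iff_add_eq_0 add.commute)
      with that r(2)[of k] show False by simp
    qed
    then have "F holomorphic_on cball 0 (r k)"
      unfolding F_def by (intro holomorphic_intros) auto
    from Cauchy_integral_circlepath_simple[OF this, of 0] r[of k]
    have "((\<lambda>u. F u / u) has_contour_integral (2 * of_real pi * \<i> * F 0)) (circlepath 0 (r k))"
      by simp
    moreover define K where "K = 2 * of_real pi * \<i>"
    ultimately have "((\<lambda>x. F (of_real (r k) * E x) * K) has_integral F 0 * K) {0..1}"
      unfolding has_contour_integral vector_derivative_circlepath
      using r[of k] by (simp add: circlepath E_def mult_ac)
    note int = this
    have "K \<noteq> 0" by (simp add: K_def)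
    then show ?thesis
      using has_integral_mult_left[OF int, of "inverse K"] by (simp add: mult.assoc)
  qed
  let ?S = "{0..1} - {1/2::real}"
  have spike: "(f has_integral y) ?S \<longleftrightarrow> (f has_integral y) {0..1}"
    for f :: "real \<Rightarrow> complex" and y
    by (rule has_integral_spike_set_eq) (auto intro: negligible_subset[of "{1/2}"])
  have lim: "(\<lambda>k. F (of_real (r k) * E x)) \<longlonglongrightarrow> F (E x)" if "x \<in> ?S" for x
  proof -
    have "E x \<noteq> -1"
    proof
      assume "E x = -1"
      then have "exp (2 * of_real pi * \<i> * of_real x) = exp (of_real pi * \<i>)"
        by (simp add: E_def exp_pi_i)
      then obtain n :: int
        where "2 * of_real pi * \<i> * of_real x = of_real pi * \<i> + (of_int (2 * n) * pi) * \<i>"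
        unfolding exp_eq by blast
      then have "Im (2 * of_real pi * \<i> * of_real x) = Im (of_real pi * \<i> + (of_int (2 * n) * pi) * \<i>)"
        by (rule arg_cong)
      then have "pi * (2 * x) = pi * (1 + 2 * real_of_int n)" by (simp add: algebra_simps)
      then have "2 * x = 1 + 2 * real_of_int n" by simp
      moreover from this that have "n = 0" by auto
      ultimately show False using that by auto
    qed
    then have "1 + E x \<noteq> 0" by (simp add: add_eq_0_iff)
    then show ?thesis
      unfolding F_def by (auto intro!: tendsto_eq_intros r_lim)
  qed
  have int: "(\<lambda>x. F (of_real (r k) * E x)) integrable_on ?S" for k
    using mean[of k] spike by blast
  have one: "(\<lambda>x. 1::real) integrable_on ?S"
    by (rule integrable_spike_set[of _ "{0..1}"]) (auto intro: negligible_subset[of "{1/2}"])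
  have le: "norm (F (of_real (r k) * E x)) \<le> 1" for k x
    using r[of k] by (intro bound) (simp add: norm_mult E1)
  note dc = dominated_convergence[OF int one le lim]
  have "integral ?S (\<lambda>x. F (of_real (r k) * E x)) = F 0" for k
    using mean[of k] spike by (intro integral_unique) blast
  with dc(2) have "integral ?S (\<lambda>x. F (E x)) = F 0"
    by (simp add: LIMSEQ_const_iff)
  with dc(1) have "((\<lambda>x. F (E x)) has_integral F 0) ?S"
    by (metis integrable_integral)
  then show ?thesis unfolding spike E_def .
qed

(* Termwise, e^(l s) is the Poisson integral of its values on a vertical line to the right of s:
   the Cayley transform sends the unit circle to that line and 0 to s. *)
lemma norm_exp_sum_le_right:
  fixes a :: "nat \<Rightarrow> 'a::complex_banach"
  assumes "finite I" and l: "\<And>n. n \<in> I \<Longrightarrow> 0 \<le> l n" and "Re s \<le> \<sigma>"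
    and B: "\<And>t. norm (\<Sum>n\<in>I. exp (Complex \<sigma> t * of_real (l n)) *\<^sub>C a n) \<le> B"
  shows "norm (\<Sum>n\<in>I. exp (s * of_real (l n)) *\<^sub>C a n) \<le> B"
proof -
  define d where "d = \<sigma> - Re s"
  define w :: "real \<Rightarrow> complex" where "w x = exp (2 * of_real pi * \<i> * of_real x)" for x
  define u where "u x = (1 - w x) / (1 + w x)" for x
  define z where "z x = s + of_real d - of_real d * u x" for x
  have "d \<ge> 0" using assms by (simp add: d_def)
  have "((\<lambda>x. exp (z x * of_real (l n)) *\<^sub>C a n) has_integral exp (s * of_real (l n)) *\<^sub>C a n) {0..1}"
    if "n \<in> I" for n
  proof -
    have "((\<lambda>x. exp (- of_real (d * l n) * u x))
      has_integral exp (- of_real (d * l n))) {0..1}"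
      using cayley_unit_circle_has_integral[of "d * l n"] l[OF that] \<open>d \<ge> 0\<close>
      by (simp add: w_def u_def)
    \<comment> \<open>The constant factor moves the line to real part \<sigma> and restores the
      value at \<open>s\<close>, because (s + d) l - d l = s l.\<close>
    from has_integral_mult_right[OF this, of "exp ((s + of_real d) * of_real (l n))"]
    have "((\<lambda>x. exp (z x * of_real (l n))) has_integral exp (s * of_real (l n))) {0..1}"
      by (simp only: mult_exp_exp z_def of_real_mult) (simp add: algebra_simps)
    from has_integral_linear[OF this bounded_linear_scaleC_left]
    show ?thesis by (simp add: o_def)
  qed
  then have int: "((\<lambda>x. \<Sum>n\<in>I. exp (z x * of_real (l n)) *\<^sub>C a n)
      has_integral (\<Sum>n\<in>I. exp (s * of_real (l n)) *\<^sub>C a n)) {0..1}"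
    by (intro has_integral_sum \<open>finite I\<close>)
  have "norm (\<Sum>n\<in>I. exp (z x * of_real (l n)) *\<^sub>C a n) \<le> B" for x
  proof -
    \<comment> \<open>This includes the parameter with \<open>w x = -1\<close>, where
      \<open>u x\<close> is 0 by convention, so the bound on the integrand holds for every
      \<open>x\<close>.\<close>
    have "Re (u x) = 0"
      unfolding u_def Re_cayley by (simp add: w_def)
    then have "z x = Complex \<sigma> (Im (z x))"
      by (simp add: z_def d_def complex_eq_iff)
    then show ?thesis by (metis B)
  qed
  from integral_norm_bound_integral[OF has_integral_integrable[OF int] integrable_const_ivl this]
  show ?thesis using integral_unique[OF int] by simp
qed

subsection \<open>Growth of the maximum modulus\<close>

text \<open>Comparison with n^(-2): eventually ln n < C l_n and ln |a_n| < -(\<sigma> + 2 C) l_n for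
  nonzero a_n, so the n-th term is at most exp (-2 C l_n) \<le> n^(-2).\<close>

lemma vvds_summable:
  assumes "vvds_coeffs a l"
  shows "summable (\<lambda>n. norm (a (Suc n)) * exp (\<sigma> * l (Suc n)))"
proof -
  have l: "0 < l n" if "n \<ge> 1" for n
    using assms that by (auto simp: vvds_coeffs_def)
  have "limsup (\<lambda>n. ereal (ln (real n) / l n)) < \<infinity>"
    using assms by (simp add: vvds_coeffs_def)
  from ereal_dense2[OF this] obtain C0 where "limsup (\<lambda>n. ereal (ln (real n) / l n)) < ereal C0"
    by blast
  from Limsup_lessD[OF this]
  have C0: "\<forall>\<^sub>F n in sequentially. ln (real n) / l n < C0" by simp
  define C where "C = max C0 0"
  have "limsup (\<lambda>n. if a n = 0 then -\<infinity> else ereal (ln (norm (a n)) / l n))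
      < ereal (- (\<sigma> + 2 * C))"
    using assms by (simp add: vvds_coeffs_def)
  note K = Limsup_lessD[OF this]
  have "\<forall>\<^sub>F n in sequentially. norm (norm (a n) * exp (\<sigma> * l n)) \<le> real n powr - 2"
    using C0 K eventually_ge_at_top[of 1]
  proof eventually_elim
    case (elim n)
    then have "0 < l n" "0 < real n" using l by auto
    show ?case
    proof (cases "a n = 0")
      case False
      with elim(2) have "ln (norm (a n)) / l n < - (\<sigma> + 2 * C)" by simp
      with \<open>0 < l n\<close> have "ln (norm (a n)) < - (\<sigma> + 2 * C) * l n"
        by (simp only: pos_divide_less_eq)
      then have 1: "ln (norm (a n)) + \<sigma> * l n \<le> - 2 * (C * l n)"
        by (simp add: algebra_simps)
      have "ln (real n) < C0 * l n"
        using elim(1) \<open>0 < l n\<close> by (simp only: pos_divide_less_eq)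
      also have "\<dots> \<le> C * l n"
        using \<open>0 < l n\<close> by (intro mult_right_mono) (auto simp: C_def)
      finally have "ln (norm (a n)) + \<sigma> * l n \<le> - 2 * ln (real n)"
        using 1 by linarith
      moreover have "norm (a n) * exp (\<sigma> * l n) = exp (ln (norm (a n)) + \<sigma> * l n)"
        using False by (simp add: exp_add)
      ultimately show ?thesis
        using \<open>0 < real n\<close> by (simp add: powr_def)
    qed simp
  qed
  then have "summable (\<lambda>n. norm (a n) * exp (\<sigma> * l n))"
    by (rule summable_comparison_test_ev) (simp add: summable_real_powr_iff)
  then show ?thesis
    by (subst summable_Suc_iff)
qed

text \<open>A mean value estimate, obtained from 1 + u \<le> exp u. It yields the Lipschitz bound
  for the terms of the series.\<close>

lemma abs_exp_diff_le:
  fixes x y :: real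
  assumes "x \<le> c" "y \<le> c"
  shows "\<bar>exp x - exp y\<bar> \<le> \<bar>x - y\<bar> * exp c"
proof -
  have *: "exp y - exp x \<le> (y - x) * exp c" if "x \<le> y" "y \<le> c" for x y :: real
  proof -
    have "exp y - exp x = exp y * (1 - exp (x - y))"
      by (simp add: algebra_simps exp_diff)
    also have "\<dots> \<le> exp y * (y - x)"
    proof (rule mult_left_mono)
      show "1 - exp (x - y) \<le> y - x"
        using exp_ge_add_one_self[of "x - y"] by linarith
    qed simp
    also have "\<dots> \<le> exp c * (y - x)"
      using that by (intro mult_right_mono) auto
    finally show ?thesis by (simp add: mult.commute)
  qed
  show ?thesis
    using *[of x y] *[of y x] assms by (cases "x \<le> y") (auto simp: abs_if)
qed

text \<open>The series is reindexed to start at 0. The growth conditions enter only as absolute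
  convergence on every vertical line, the ordering of the exponents only as minimality of the first
  one.\<close>

locale entire_vvds_series =
  fixes f :: "complex \<Rightarrow> 'a::complex_banach" and a :: "nat \<Rightarrow> 'a" and l :: "nat \<Rightarrow> real"
  assumes sums_f: "\<And>s. (\<lambda>n. exp (s * of_real (l n)) *\<^sub>C a n) sums f s"
    and summable_norm_coeffs: "\<And>\<sigma>. summable (\<lambda>n. norm (a n) * exp (\<sigma> * l n))"
    and exponent_pos: "\<And>n. 0 < l n"
    and exponent_first: "\<And>n. l 0 \<le> l n"
    and not_zero: "\<exists>s. f s \<noteq> 0"
begin

lemma norm_term: "norm (exp (s * of_real (l n)) *\<^sub>C a n) = norm (a n) * exp (Re s * l n)"
  by (simp add: norm_scaleC norm_exp_eq_Re)

text \<open>A bound for \<open>norm (f s)\<close> that depends only on the real part of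
  \<open>s\<close>; it makes the supremum over a vertical line finite.\<close>

definition majorant :: "real \<Rightarrow> real" where
  "majorant \<sigma> = (\<Sum>n. norm (a n) * exp (\<sigma> * l n))"

lemma norm_le_majorant: "norm (f s) \<le> majorant (Re s)"
  using summable_norm[of "\<lambda>n. exp (s * of_real (l n)) *\<^sub>C a n"] sums_f[of s]
    summable_norm_coeffs[of "Re s"]
  by (simp add: norm_term majorant_def sums_iff)

lemma bdd_above_norm: "bdd_above (range (\<lambda>t. norm (f (Complex \<sigma> t))))"
  using norm_le_majorant[of "Complex \<sigma> _"] by (auto intro!: bdd_aboveI2)

lemma norm_le_max_modulus: "norm (f s) \<le> max_modulus f (Re s)"
proof -
  have "norm (f (Complex (Re s) (Im s))) \<le> max_modulus f (Re s)"
    unfolding max_modulus_def by (rule cSUP_upper[OF UNIV_I bdd_above_norm])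
  then show ?thesis by simp
qed

lemma max_modulus_le: "(\<And>t. norm (f (Complex \<sigma> t)) \<le> B) \<Longrightarrow> max_modulus f \<sigma> \<le> B"
  unfolding max_modulus_def by (rule cSUP_least) auto

text \<open>Termwise, the difference of the exponentials costs a factor \<open>l n\<close>, which
  \<open>l n \<le> exp (l n)\<close> absorbs by raising \<open>S\<close> to \<open>S + 1\<close>.
  The bound is uniform in \<open>t\<close>, as needed for suprema.\<close>

lemma norm_diff_le:
  assumes "\<sigma> \<le> S" "\<sigma>' \<le> S"
  shows "norm (f (Complex \<sigma> t) - f (Complex \<sigma>' t)) \<le> majorant (S + 1) * \<bar>\<sigma> - \<sigma>'\<bar>"
proof -
  let ?d = "\<lambda>n. exp (Complex \<sigma> t * of_real (l n)) *\<^sub>C a n - exp (Complex \<sigma>' t * of_real (l n)) *\<^sub>C a n"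
  have sums: "?d sums (f (Complex \<sigma> t) - f (Complex \<sigma>' t))"
    by (intro sums_diff sums_f)
  have bound: "norm (?d n) \<le> norm (a n) * exp ((S + 1) * l n) * \<bar>\<sigma> - \<sigma>'\<bar>" for n
  proof -
    \<comment> \<open>The imaginary part contributes a common factor of modulus 1, which leaves a
      difference of real exponentials.\<close>
    have "exp (Complex r t * of_real (l n)) = of_real (exp (r * l n)) * exp (Complex 0 (t * l n))" for r
      by (simp add: Complex_eq algebra_simps exp_add exp_of_real[symmetric])
    then have "?d n = ((of_real (exp (\<sigma> * l n) - exp (\<sigma>' * l n)) * exp (Complex 0 (t * l n)))) *\<^sub>C a n"
      using linear_diff[OF bounded_linear.linear[OF bounded_linear_scaleC_left[of "a n"]]]
      by (simp add: left_diff_distrib)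
    then have "norm (?d n) = \<bar>exp (\<sigma> * l n) - exp (\<sigma>' * l n)\<bar> * norm (a n)"
      by (simp add: norm_scaleC norm_mult norm_exp_eq_Re del: of_real_diff)
    also have "\<bar>exp (\<sigma> * l n) - exp (\<sigma>' * l n)\<bar> \<le> \<bar>\<sigma> * l n - \<sigma>' * l n\<bar> * exp (S * l n)"
      using assms exponent_pos[of n] by (intro abs_exp_diff_le mult_right_mono) auto
    also have "\<bar>\<sigma> * l n - \<sigma>' * l n\<bar> = \<bar>\<sigma> - \<sigma>'\<bar> * l n"
      using exponent_pos[of n] by (simp add: left_diff_distrib[symmetric] abs_mult)
    also have "\<bar>\<sigma> - \<sigma>'\<bar> * l n * exp (S * l n) * norm (a n)
        = l n * (norm (a n) * exp (S * l n) * \<bar>\<sigma> - \<sigma>'\<bar>)"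
      by (simp only: mult_ac)
    also have "\<dots> \<le> exp (l n) * (norm (a n) * exp (S * l n) * \<bar>\<sigma> - \<sigma>'\<bar>)"
    proof (rule mult_right_mono)
      show "l n \<le> exp (l n)" using exp_ge_add_one_self[of "l n"] by linarith
    qed simp
    also have "\<dots> = norm (a n) * exp ((S + 1) * l n) * \<bar>\<sigma> - \<sigma>'\<bar>"
      by (simp add: distrib_right exp_add)
    finally show ?thesis by (simp add: mult_right_mono)
  qed
  have summ: "summable (\<lambda>n. norm (a n) * exp ((S + 1) * l n) * \<bar>\<sigma> - \<sigma>'\<bar>)"
    by (intro summable_mult2 summable_norm_coeffs)
  have "summable (\<lambda>n. norm (?d n))"
    by (rule summable_comparison_test'[OF summ]) (use bound in auto)
  then have "norm (\<Sum>n. ?d n) \<le> (\<Sum>n. norm (?d n))" by (rule summable_norm)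
  also have "\<dots> \<le> (\<Sum>n. norm (a n) * exp ((S + 1) * l n) * \<bar>\<sigma> - \<sigma>'\<bar>)"
    by (intro suminf_le bound summ) fact
  also have "\<dots> = majorant (S + 1) * \<bar>\<sigma> - \<sigma>'\<bar>"
    unfolding majorant_def by (rule suminf_mult2[symmetric, OF summable_norm_coeffs])
  finally show ?thesis using sums by (simp add: sums_iff)
qed

lemma isCont_max_modulus: "isCont (max_modulus f) \<sigma>"
proof -
  \<comment> \<open>The Lipschitz constant of \<open>norm_diff_le\<close> with
    \<open>S = \<sigma> + 1\<close>, valid on a neighbourhood of \<sigma>.\<close>
  define K where "K = majorant (\<sigma> + 1 + 1)"
  have le: "max_modulus f x \<le> max_modulus f y + K * \<bar>x - y\<bar>" if "x \<le> \<sigma> + 1" "y \<le> \<sigma> + 1" for x y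
  proof (rule max_modulus_le)
    fix t
    have "norm (f (Complex x t)) \<le> norm (f (Complex y t)) + norm (f (Complex x t) - f (Complex y t))"
      by (rule norm_triangle_sub)
    then show "norm (f (Complex x t)) \<le> max_modulus f y + K * \<bar>x - y\<bar>"
      using norm_le_max_modulus[of "Complex y t"] norm_diff_le[OF that, of t]
      unfolding K_def complex.sel by linarith
  qed
  have ev: "\<forall>\<^sub>F x in at \<sigma>. x \<le> \<sigma> + 1"
    using eventually_at_in_open'[of "{..<\<sigma> + 1}" \<sigma>] by (auto elim: eventually_mono)
  have "((\<lambda>x. max_modulus f x - max_modulus f \<sigma>) \<longlongrightarrow> 0) (at \<sigma>)"
  proof (rule Lim_null_comparison)
    show "\<forall>\<^sub>F x in at \<sigma>. norm (max_modulus f x - max_modulus f \<sigma>) \<le> K * \<bar>x - \<sigma>\<bar>"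
      using ev
    proof eventually_elim
      case (elim x)
      then show ?case
        using le[of x \<sigma>] le[of \<sigma> x] by (auto simp: abs_le_iff abs_minus_commute)
    qed
    have "((\<lambda>x. K * \<bar>x - \<sigma>\<bar>) \<longlongrightarrow> K * \<bar>\<sigma> - \<sigma>\<bar>) (at \<sigma>)"
      by (intro tendsto_intros)
    then show "((\<lambda>x. K * \<bar>x - \<sigma>\<bar>) \<longlongrightarrow> 0) (at \<sigma>)" by simp
  qed
  then show ?thesis
    by (simp add: isCont_def LIM_zero_iff)
qed

(* Dividing by e^(l 0 * s) leaves nonnegative exponents, so the maximum principle still applies;
   the extra factor is what makes the maximum modulus strictly increasing. *)
lemma max_modulus_growth:
  assumes "\<sigma> \<le> \<sigma>'"
  shows "max_modulus f \<sigma> * exp (l 0 * (\<sigma>' - \<sigma>)) \<le> max_modulus f \<sigma>'"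
proof -
  \<comment> \<open>The Poisson bound concerns finite sums, so \<open>f\<close> is replaced by its
    partial sums; this tail controls the error uniformly on a vertical line and vanishes in the
    limit.\<close>
  define tail where "tail N r = (\<Sum>n. norm (a (n + N)) * exp (r * l (n + N)))" for N r
  have tail: "norm (f s - (\<Sum>n<N. exp (s * of_real (l n)) *\<^sub>C a n)) \<le> tail N (Re s)" for s N
  proof -
    let ?u = "\<lambda>n. exp (s * of_real (l n)) *\<^sub>C a n"
    have "(\<lambda>n. ?u (n + N)) sums (f s - (\<Sum>n<N. ?u n))"
      by (rule sums_split_initial_segment[OF sums_f])
    moreover have "summable (\<lambda>n. norm (?u (n + N)))"
      unfolding norm_term by (intro summable_ignore_initial_segment summable_norm_coeffs)
    ultimately show ?thesis
      using summable_norm[of "\<lambda>n. ?u (n + N)"] by (simp add: norm_term tail_def sums_iff)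
  qed
  have tail0: "(\<lambda>N. tail N r) \<longlonglongrightarrow> 0" for r
    unfolding tail_def by (rule suminf_exist_split2[OF summable_norm_coeffs])
  have "norm (f s) * exp (l 0 * (\<sigma>' - \<sigma>)) \<le> max_modulus f \<sigma>'" if s: "Re s = \<sigma>" for s
  proof -
    let ?P = "\<lambda>N z. \<Sum>n<N. exp (z * of_real (l n)) *\<^sub>C a n"
    let ?R = "\<lambda>N z. \<Sum>n<N. exp (z * of_real (l n - l 0)) *\<^sub>C a n"
    have fact: "?P N z = exp (z * of_real (l 0)) *\<^sub>C ?R N z" for N z
    proof -
      have "exp (z * of_real (l 0)) *\<^sub>C (exp (z * of_real (l n - l 0)) *\<^sub>C a n)
          = exp (z * of_real (l n)) *\<^sub>C a n" for n
        by (simp add: scaleC_scaleC mult_exp_exp right_diff_distrib)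
      then show ?thesis
        by (simp only: linear_sum[OF bounded_linear.linear[OF bounded_linear_scaleC_right]])
    qed
    then have norm_P: "norm (?P N z) = exp (Re z * l 0) * norm (?R N z)" for N z
      by (simp only: norm_scaleC norm_exp_eq_Re) simp
    have bound: "norm (?P N s) * exp (l 0 * (\<sigma>' - \<sigma>)) \<le> max_modulus f \<sigma>' + tail N \<sigma>'" for N
    proof -
      let ?B = "exp (- (\<sigma>' * l 0)) * (max_modulus f \<sigma>' + tail N \<sigma>')"
      have "norm (?R N s) \<le> ?B"
      proof (rule norm_exp_sum_le_right)
        fix t
        have "norm (?P N (Complex \<sigma>' t)) \<le> max_modulus f \<sigma>' + tail N \<sigma>'"
          using tail[of "Complex \<sigma>' t" N] norm_le_max_modulus[of "Complex \<sigma>' t"]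
            norm_triangle_sub[of "?P N (Complex \<sigma>' t)" "f (Complex \<sigma>' t)"]
          by (simp add: norm_minus_commute)
        then show "norm (?R N (Complex \<sigma>' t)) \<le> ?B"
          unfolding norm_P by (simp add: exp_minus field_simps)
      qed (use exponent_first assms s in auto)
      then have "norm (?P N s) * exp (l 0 * (\<sigma>' - \<sigma>))
          \<le> exp (\<sigma> * l 0) * ?B * exp (l 0 * (\<sigma>' - \<sigma>))"
        unfolding norm_P s by (intro mult_right_mono mult_left_mono) auto
      also have "\<dots> = (exp (\<sigma> * l 0) * exp (- (\<sigma>' * l 0)) * exp (l 0 * (\<sigma>' - \<sigma>)))
          * (max_modulus f \<sigma>' + tail N \<sigma>')"
        by (simp only: mult_ac)
      also have "exp (\<sigma> * l 0) * exp (- (\<sigma>' * l 0)) * exp (l 0 * (\<sigma>' - \<sigma>)) = 1"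
        by (simp only: mult_exp_exp) (simp add: algebra_simps)
      finally show ?thesis by simp
    qed
    have lim: "(\<lambda>N. norm (?P N s) * exp (l 0 * (\<sigma>' - \<sigma>))) \<longlonglongrightarrow> norm (f s) * exp (l 0 * (\<sigma>' - \<sigma>))"
      using sums_f[of s] unfolding sums_def by (intro tendsto_intros)
    have "(\<lambda>N. max_modulus f \<sigma>' + tail N \<sigma>') \<longlonglongrightarrow> max_modulus f \<sigma>' + 0"
      by (intro tendsto_intros tail0)
    from LIMSEQ_le[OF lim this] bound show ?thesis by simp
  qed
  then have "max_modulus f \<sigma> \<le> max_modulus f \<sigma>' / exp (l 0 * (\<sigma>' - \<sigma>))"
    by (intro max_modulus_le) (simp add: pos_le_divide_eq)
  then show ?thesis by (simp add: pos_le_divide_eq)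
qed

end

text \<open>These are the properties of a maximum modulus that make \<open>inv M\<close> a two-sided
  inverse near infinity; strictness from some point on is enough for limits.\<close>

definition regular_growth :: "(real \<Rightarrow> real) \<Rightarrow> bool" where
  "regular_growth M \<longleftrightarrow>
     continuous_on UNIV M \<and> mono M \<and> filterlim M at_top at_top \<and> (\<exists>x0. strict_mono_on {x0..} M)"

lemma (in entire_vvds_series) regular_growth_max_modulus: "regular_growth (max_modulus f)"
proof -
  \<comment> \<open>On the line through a point where \<open>f\<close> is nonzero the maximum
    modulus is positive; from there on the factor \<open>exp (l 0 * (y - x))\<close> gives strict
    increase and divergence.\<close>
  obtain s where "f s \<noteq> 0" using not_zero by blast
  define r where "r = Re s"
  have pos0: "0 < max_modulus f r"
    using norm_le_max_modulus[of s] \<open>f s \<noteq> 0\<close> unfolding r_def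
    by (meson less_le_trans zero_less_norm_iff)
  have nonneg: "0 \<le> max_modulus f x" for x
    using order_trans[OF norm_ge_zero norm_le_max_modulus[of "Complex x 0"]] by simp
  have "mono (max_modulus f)"
  proof (rule monoI)
    fix x y :: real assume "x \<le> y"
    then have "max_modulus f x * 1 \<le> max_modulus f x * exp (l 0 * (y - x))"
      using exponent_pos[of 0] nonneg by (intro mult_left_mono) auto
    with max_modulus_growth[OF \<open>x \<le> y\<close>] show "max_modulus f x \<le> max_modulus f y" by simp
  qed
  moreover have "strict_mono_on {r..} (max_modulus f)"
  proof (rule strict_mono_onI)
    fix x y :: real assume "x \<in> {r..}" "x < y"
    then have "0 < max_modulus f x" using pos0 \<open>mono _\<close> by (metis atLeast_iff less_le_trans monoD)
    then have "max_modulus f x * 1 < max_modulus f x * exp (l 0 * (y - x))"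
      using exponent_pos[of 0] \<open>x < y\<close> by (intro mult_strict_left_mono) auto
    with max_modulus_growth[of x y] \<open>x < y\<close> show "max_modulus f x < max_modulus f y" by simp
  qed
  moreover have "filterlim (max_modulus f) at_top at_top"
  proof (rule filterlim_at_top_mono)
    have "filterlim (\<lambda>y. - r + y) at_top at_top"
      by (rule filterlim_tendsto_add_at_top[OF tendsto_const filterlim_ident])
    then have "filterlim (\<lambda>y. l 0 * (y - r)) at_top at_top"
      using exponent_pos[of 0]
      by (intro filterlim_tendsto_pos_mult_at_top[OF tendsto_const]) auto
    then show "filterlim (\<lambda>y. max_modulus f r * exp (l 0 * (y - r))) at_top at_top"
      using pos0 by (intro filterlim_tendsto_pos_mult_at_top[OF tendsto_const])
          (auto intro: filterlim_compose[OF exp_at_top])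
    show "\<forall>\<^sub>F y in at_top. max_modulus f r * exp (l 0 * (y - r)) \<le> max_modulus f y"
      using eventually_ge_at_top[of r] by eventually_elim (rule max_modulus_growth)
  qed
  ultimately show ?thesis
    by (auto simp: regular_growth_def isCont_max_modulus intro!: continuous_at_imp_continuous_on)
qed

lemma entire_vvds_regular_growth:
  assumes "entire_vvds f"
  shows "regular_growth (max_modulus f)"
proof -
  obtain a l where al: "vvds_coeffs a l"
    and sums: "\<And>s. (\<lambda>n. exp (s * complex_of_real (l (Suc n))) *\<^sub>C a (Suc n)) sums f s"
    and "\<exists>s. f s \<noteq> 0"
    using assms by (auto simp: entire_vvds_def)
  have step: "0 < l n" "l n < l (Suc n)" if "n \<ge> 1" for n
    using al that by (auto simp: vvds_coeffs_def)
  have "l (Suc 0) \<le> l (Suc n)" for n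
  proof (induction n)
    case (Suc n)
    with step(2)[of "Suc n"] show ?case by simp
  qed simp
  then interpret entire_vvds_series f "\<lambda>n. a (Suc n)" "\<lambda>n. l (Suc n)"
    using sums vvds_summable[OF al] step \<open>\<exists>s. f s \<noteq> 0\<close> by unfold_locales auto
  show ?thesis by (rule regular_growth_max_modulus)
qed

subsection \<open>Relative growth as a change of variable\<close>

text \<open>\<open>inv M\<close> is only a chosen preimage, correct on the range of
  \<open>M\<close>. The intermediate value theorem puts every value from \<open>M x0\<close> on into
  the range, and strictness beyond \<open>x0\<close> makes the preimage of a large value
  unique.\<close>

lemma regular_growth_inv:
  assumes "regular_growth M"
  shows eventually_f_inv_regular_growth: "\<forall>\<^sub>F y in at_top. M (inv M y) = y"
    and filterlim_inv_regular_growth: "filterlim (inv M) at_top at_top"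
    and eventually_inv_f_regular_growth: "\<forall>\<^sub>F x in at_top. inv M (M x) = x"
proof -
  have cont: "continuous_on UNIV M" and mono: "mono M" and top: "filterlim M at_top at_top"
    using assms by (auto simp: regular_growth_def)
  obtain x0 where strict: "strict_mono_on {x0..} M"
    using assms by (auto simp: regular_growth_def)
  have surj: "M (inv M y) = y" if y: "M x0 \<le> y" for y
  proof -
    have "\<forall>\<^sub>F x in at_top. y \<le> M x \<and> x0 \<le> x"
      using top by (auto simp: filterlim_at_top intro: eventually_conj eventually_ge_at_top)
    then obtain x1 where "y \<le> M x1" "x0 \<le> x1"
      by (auto dest: eventually_happens)
    with IVT'[of M x0 y x1] y cont obtain x where "M x = y"
      using continuous_on_subset by blast
    then show ?thesis by (metis f_inv_into_f rangeI)
  qed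
  show right: "\<forall>\<^sub>F y in at_top. M (inv M y) = y"
    using eventually_ge_at_top[of "M x0"] by eventually_elim (rule surj)
  show "filterlim (inv M) at_top at_top"
    unfolding filterlim_at_top
  proof
    fix c
    show "\<forall>\<^sub>F y in at_top. c \<le> inv M y"
      using right eventually_gt_at_top[of "M c"]
      by eventually_elim (metis linorder_not_less mono monoD less_imp_le)
  qed
  show "\<forall>\<^sub>F x in at_top. inv M (M x) = x"
    using eventually_gt_at_top[of x0]
  proof eventually_elim
    case (elim x)
    define z where "z = inv M (M x)"
    have z: "M z = M x" by (simp add: z_def f_inv_into_f)
    \<comment> \<open>Hence every preimage of \<open>M x\<close> lies beyond \<open>x0\<close>,
      where \<open>M\<close> is injective.\<close>
    have "M x0 < M x" using strict elim by (auto simp: strict_mono_on_def)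
    with z mono have "x0 < z" by (metis linorder_not_less monoD)
    with z elim strict show ?case
      unfolding z_def[symmetric]
      by (metis atLeast_iff less_imp_le less_irrefl linorder_neqE strict_mono_onD)
  qed
qed

text \<open>Both \<open>rel_growth g f\<close> and \<open>rel_growth f g\<close> tend to infinity,
  and the second is eventually a right inverse of the first. So \<open>rel_growth g f\<close>
  carries the filter \<open>at_top\<close> onto itself, which preserves upper and lower limits
  exactly.\<close>

lemma
  assumes "entire_vvds f" "entire_vvds g"
  shows filterlim_rel_growth: "filterlim (rel_growth g f) at_top at_top"
    and eventually_max_modulus_rel_growth:
      "\<forall>\<^sub>F \<sigma> in at_top. max_modulus g (rel_growth g f \<sigma>) = max_modulus f \<sigma>"
    and filtermap_rel_growth: "filtermap (rel_growth g f) at_top = at_top"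
proof -
  note f = entire_vvds_regular_growth[OF assms(1)]
  note g = entire_vvds_regular_growth[OF assms(2)]
  have rel: "rel_growth g f = (\<lambda>\<sigma>. inv (max_modulus g) (max_modulus f \<sigma>))"
    "rel_growth f g = (\<lambda>\<sigma>. inv (max_modulus f) (max_modulus g \<sigma>))"
    by (auto simp: rel_growth_def inv_max_modulus_def)
  have top: "filterlim (max_modulus f) at_top at_top" "filterlim (max_modulus g) at_top at_top"
    using f g by (auto simp: regular_growth_def)
  show lim: "filterlim (rel_growth g f) at_top at_top"
    unfolding rel by (rule filterlim_compose[OF filterlim_inv_regular_growth[OF g] top(1)])
  have lim': "filterlim (rel_growth f g) at_top at_top"
    unfolding rel by (rule filterlim_compose[OF filterlim_inv_regular_growth[OF f] top(2)])
  show "\<forall>\<^sub>F \<sigma> in at_top. max_modulus g (rel_growth g f \<sigma>) = max_modulus f \<sigma>"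
    unfolding rel
    using eventually_compose_filterlim[OF eventually_f_inv_regular_growth[OF g] top(1)] .
  have "\<forall>\<^sub>F x in at_top. rel_growth g f (rel_growth f g x) = x"
    using eventually_compose_filterlim[OF eventually_f_inv_regular_growth[OF f] top(2)]
      eventually_inv_f_regular_growth[OF g]
    unfolding rel by eventually_elim simp
  from filtermap_fun_inverse[OF lim' lim this]
  show "filtermap (rel_growth g f) at_top = at_top" .
qed

section \<open>Iterated logarithms, and upper and lower limits under the change of variable\<close>

lemma filterlim_iter_log: "filterlim (iter_log k) at_top at_top"
proof -
  have "filterlim (u ^^ n) at_top at_top" if "filterlim u at_top at_top" for u :: "real \<Rightarrow> real" and n
    using that by (induction n) (auto simp: filterlim_ident id_def o_def intro: filterlim_compose)
  from this[OF ln_at_top, of "nat k"] this[OF exp_at_top, of "nat (- k)"] show ?thesis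
    by (cases "0 \<le> k") (simp_all add: iter_log_def[abs_def])
qed

text \<open>The case \<open>k = 0\<close> relies on \<open>iter_log (-1) = exp\<close>. With it, the
  orders become ratios of logarithms of the same functions whose powers form the types.\<close>

lemma iter_log_eq_ln:
  assumes "k \<ge> 0"
  shows "iter_log k x = ln (iter_log (k - 1) x)"
proof (cases "k = 0")
  case False
  with assms have "nat k = Suc (nat (k - 1))" by simp
  with False assms show ?thesis by (simp add: iter_log_def)
qed (simp add: iter_log_def)

lemma Liminf_filtermap: "Liminf (filtermap f F) g = Liminf F (\<lambda>x. g (f x))"
  for g :: "_ \<Rightarrow> _ :: complete_linorder"
proof (rule antisym[OF Liminf_filtermap_le])
  show "Liminf F (\<lambda>x. g (f x)) \<le> Liminf (filtermap f F) g"
    unfolding le_Liminf_iff eventually_filtermap using less_LiminfD by blast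
qed

lemma Limsup_filtermap: "Limsup (filtermap f F) g = Limsup F (\<lambda>x. g (f x))"
  for g :: "_ \<Rightarrow> _ :: complete_linorder"
proof (rule antisym[OF _ Limsup_filtermap_ge])
  show "Limsup (filtermap f F) g \<le> Limsup F (\<lambda>x. g (f x))"
    unfolding Limsup_le_iff eventually_filtermap using Limsup_lessD by blast
qed

text \<open>The substitution x = \<open>rel_growth g f\<close> \<sigma> turns
  \<open>max_modulus g x\<close> into \<open>max_modulus f\<close> \<sigma>. An arbitrary
  \<open>v\<close> covers orders and types at once.\<close>

lemma
  fixes v :: "real \<Rightarrow> real \<Rightarrow> ereal"
  assumes "entire_vvds f" "entire_vvds g"
  shows Limsup_rel_growth_subst: "Limsup at_top (\<lambda>x. v (rel_growth h g x) x) =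
      Limsup at_top (\<lambda>\<sigma>. v (rel_growth h f \<sigma>) (rel_growth g f \<sigma>))" (is ?sup)
    and Liminf_rel_growth_subst: "Liminf at_top (\<lambda>x. v (rel_growth h g x) x) =
      Liminf at_top (\<lambda>\<sigma>. v (rel_growth h f \<sigma>) (rel_growth g f \<sigma>))" (is ?inf)
proof -
  have eq: "\<forall>\<^sub>F \<sigma> in at_top. v (rel_growth h g (rel_growth g f \<sigma>)) (rel_growth g f \<sigma>)
      = v (rel_growth h f \<sigma>) (rel_growth g f \<sigma>)"
    using eventually_max_modulus_rel_growth[OF assms]
  proof eventually_elim
    case (elim \<sigma>)
    then show ?case by (simp add: rel_growth_def[of h])
  qed
  show ?sup
    using Limsup_filtermap[of "rel_growth g f" at_top "\<lambda>x. v (rel_growth h g x) x"] Limsup_eq[OF eq]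
    by (simp add: filtermap_rel_growth[OF assms])
  show ?inf
    using Liminf_filtermap[of "rel_growth g f" at_top "\<lambda>x. v (rel_growth h g x) x"] Liminf_eq[OF eq]
    by (simp add: filtermap_rel_growth[OF assms])
qed

subsection \<open>Limits of quotients\<close>

text \<open>For every b' > b the factor \<open>V\<close> is eventually below b'; as \<open>W\<close>
  is nonnegative, the constant b' can be taken out of the upper limit.\<close>

lemma Limsup_mult_upper:
  fixes V W X :: "'x \<Rightarrow> real"
  assumes "F \<noteq> bot" and X: "\<forall>\<^sub>F x in F. X x \<le> V x * W x" and W: "\<forall>\<^sub>F x in F. 0 \<le> W x"
    and b: "Limsup F (\<lambda>x. ereal (V x)) = ereal b" "0 \<le> b"
    and r: "Limsup F (\<lambda>x. ereal (W x)) = ereal r" "0 < r"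
    and a: "Limsup F (\<lambda>x. ereal (X x)) = ereal a"
  shows "a \<le> b * r"
proof -
  have "a / r \<le> b"
  proof (rule dense_ge)
    fix b' assume "b < b'"
    then have "Limsup F (\<lambda>x. ereal (V x)) < ereal b'" by (simp add: b)
    from Limsup_lessD[OF this] X W
    have "\<forall>\<^sub>F x in F. ereal (X x) \<le> ereal b' * ereal (W x)"
    proof eventually_elim
      case (elim x)
      then have "V x * W x \<le> b' * W x" by (intro mult_right_mono) auto
      with elim show ?case by simp
    qed
    from Limsup_mono[OF this] have "ereal a \<le> ereal b' * ereal r"
      using Limsup_ereal_mult_left[OF \<open>F \<noteq> bot\<close>, of b' "\<lambda>x. ereal (W x)"] \<open>b < b'\<close> b(2)
      by (simp add: a r)
    then show "a / r \<le> b'" using r(2) by (simp add: pos_divide_le_eq)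
  qed
  then show ?thesis using r(2) by (simp add: pos_divide_le_eq)
qed

text \<open>Here \<open>V\<close> is eventually above any c' with 0 < c' < c. Only one factor needs
  a lower limit, since the other keeps its upper limit.\<close>

lemma Limsup_mult_lower:
  fixes V W X :: "'x \<Rightarrow> real"
  assumes "F \<noteq> bot" and X: "\<forall>\<^sub>F x in F. V x * W x \<le> X x" and W: "\<forall>\<^sub>F x in F. 0 \<le> W x"
    and c: "Liminf F (\<lambda>x. ereal (V x)) = ereal c" "0 < c"
    and r: "Limsup F (\<lambda>x. ereal (W x)) = ereal r" "0 < r"
    and a: "Limsup F (\<lambda>x. ereal (X x)) = ereal a"
  shows "c * r \<le> a"
proof -
  have "c \<le> a / r"
  proof (rule dense_le_bounded[OF c(2)])
    fix c' assume "0 < c'" "c' < c"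
    then have "ereal c' < Liminf F (\<lambda>x. ereal (V x))" by (simp add: c)
    from less_LiminfD[OF this] X W
    have "\<forall>\<^sub>F x in F. ereal c' * ereal (W x) \<le> ereal (X x)"
    proof eventually_elim
      case (elim x)
      then have "c' * W x \<le> V x * W x" by (intro mult_right_mono) auto
      with elim show ?case by simp
    qed
    from Limsup_mono[OF this] have "ereal c' * ereal r \<le> ereal a"
      using Limsup_ereal_mult_left[OF \<open>F \<noteq> bot\<close>, of c' "\<lambda>x. ereal (W x)"] \<open>0 < c'\<close>
      by (simp add: a r)
    then show "c' \<le> a / r" using r(2) by (simp add: pos_le_divide_eq)
  qed
  then show ?thesis using r(2) by (simp add: pos_le_divide_eq)
qed

lemma ereal_powr_inverse_le:
  assumes "0 \<le> y" "y \<le> ereal (d powr c)" "0 \<le> d" "0 < c"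
  shows "ereal_powr y (1 / c) \<le> ereal d"
proof -
  obtain z where z: "y = ereal z" "0 \<le> z" "z \<le> d powr c"
    using assms by (cases y) auto
  then have "z powr (1 / c) \<le> (d powr c) powr (1 / c)"
    using assms by (intro powr_mono2) auto
  with z assms show ?thesis by (simp add: ereal_powr_def powr_powr)
qed

lemma less_powr_of_ereal_powr_less:
  assumes "0 \<le> y" "ereal_powr y (1 / c) < ereal d" "0 < c"
  shows "y < ereal (d powr c)"
proof -
  obtain z where z: "y = ereal z" "0 \<le> z" "z powr (1 / c) < d"
    using assms by (cases y) (auto simp: ereal_powr_def)
  then have "(z powr (1 / c)) powr c < d powr c"
    using assms by (intro powr_less_mono2) auto
  with z assms show ?thesis by (simp add: powr_powr)
qed

text \<open>In the degenerate cases the quotient is 0: \<open>v = 0\<close> forces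
  \<open>x = 0\<close>, and division by \<infinity> gives 0 in \<open>ereal\<close>.\<close>

lemma ereal_divide_le_of_le_mult:
  fixes x v :: ereal
  assumes "0 \<le> x" "0 \<le> v" "x \<le> ereal k * v" "0 \<le> k"
  shows "x / v \<le> ereal k"
proof (cases v)
  case (real w)
  with assms show ?thesis
    by (cases "w = 0") (auto simp: ereal_divide_le_pos mult.commute zero_ereal_def[symmetric])
qed (use assms in auto)

text \<open>If d exceeds the upper limit of \<open>W\<close>, then eventually \<open>X\<close> is at
  most d^c \<open>V\<close>. Taking upper or lower limits of both sides, dividing and extracting the
  root bounds the quotient by d, and d is arbitrary.\<close>

lemma powr_ratio_lower:
  fixes V W X :: "'x \<Rightarrow> real"
  assumes F: "F \<noteq> bot" and c: "0 < c"
    and X: "\<forall>\<^sub>F x in F. 0 \<le> X x \<and> X x \<le> V x * W x powr c"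
    and nonneg: "\<forall>\<^sub>F x in F. 0 \<le> V x \<and> 0 \<le> W x"
  shows "ereal_powr (Limsup F (\<lambda>x. ereal (X x)) / Limsup F (\<lambda>x. ereal (V x))) (1 / c)
      \<le> Limsup F (\<lambda>x. ereal (W x))"
    and "ereal_powr (Liminf F (\<lambda>x. ereal (X x)) / Liminf F (\<lambda>x. ereal (V x))) (1 / c)
      \<le> Limsup F (\<lambda>x. ereal (W x))"
proof -
  let ?D = "Limsup F (\<lambda>x. ereal (W x))"
  have X0: "\<forall>\<^sub>F x in F. 0 \<le> ereal (X x)" using X by eventually_elim simp
  have V0: "\<forall>\<^sub>F x in F. 0 \<le> ereal (V x)" using nonneg by eventually_elim simp
  have W0: "\<forall>\<^sub>F x in F. 0 \<le> ereal (W x)" using nonneg by eventually_elim simp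
  note nn = le_Limsup[OF F X0] le_Limsup[OF F V0] Liminf_bounded[OF X0] Liminf_bounded[OF V0]
  have bound: "\<forall>\<^sub>F x in F. ereal (X x) \<le> ereal (d powr c) * ereal (V x)" if "?D < ereal d" for d
    using X nonneg Limsup_lessD[OF that]
  proof eventually_elim
    case (elim x)
    then have "V x * W x powr c \<le> V x * d powr c"
      using c by (intro mult_left_mono powr_mono2) auto
    with elim show ?case by (simp add: mult.commute)
  qed
  \<comment> \<open>It suffices to test real d above the upper limit; these are nonnegative, and
    there are none if the upper limit is \<infinity>.\<close>
  have dense: "y \<le> ?D" if "\<And>d. 0 \<le> d \<Longrightarrow> ?D < ereal d \<Longrightarrow> y \<le> ereal d" for y
  proof (rule dense_ge)
    fix z assume "?D < z"
    from ereal_dense2[OF this] obtain d where d: "?D < ereal d" "ereal d < z" by blast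
    have "0 \<le> d"
      using le_less_trans[OF le_Limsup[OF F W0] d(1)] by simp
    from that[OF this d(1)] d(2) show "y \<le> z" by simp
  qed
  show "ereal_powr (Limsup F (\<lambda>x. ereal (X x)) / Limsup F (\<lambda>x. ereal (V x))) (1 / c) \<le> ?D"
  proof (rule dense)
    fix d :: real assume d: "0 \<le> d" "?D < ereal d"
    have "Limsup F (\<lambda>x. ereal (X x)) \<le> ereal (d powr c) * Limsup F (\<lambda>x. ereal (V x))"
      using Limsup_mono[OF bound[OF d(2)]] by (simp only: Limsup_ereal_mult_left[OF F powr_ge_zero])
    then show "ereal_powr (Limsup F (\<lambda>x. ereal (X x)) / Limsup F (\<lambda>x. ereal (V x))) (1 / c) \<le> ereal d"
      using c d nn by (intro ereal_powr_inverse_le ereal_divide_le_of_le_mult)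
        (auto intro: zero_le_divide_ereal)
  qed
  show "ereal_powr (Liminf F (\<lambda>x. ereal (X x)) / Liminf F (\<lambda>x. ereal (V x))) (1 / c) \<le> ?D"
  proof (rule dense)
    fix d :: real assume d: "0 \<le> d" "?D < ereal d"
    have "Liminf F (\<lambda>x. ereal (X x)) \<le> ereal (d powr c) * Liminf F (\<lambda>x. ereal (V x))"
      using Liminf_mono[OF bound[OF d(2)]] by (simp only: Liminf_ereal_mult_left[OF F powr_ge_zero])
    then show "ereal_powr (Liminf F (\<lambda>x. ereal (X x)) / Liminf F (\<lambda>x. ereal (V x))) (1 / c) \<le> ereal d"
      using c d nn by (intro ereal_powr_inverse_le ereal_divide_le_of_le_mult)
        (auto intro: zero_le_divide_ereal)
  qed
qed

text \<open>Otherwise some d separates the root from the upper limit of \<open>W\<close>. Then the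
  upper limit of \<open>X\<close> is below d^b times the lower limit of \<open>V\<close>, so
  \<open>W\<close> > d is eventually impossible, a contradiction.\<close>

lemma powr_ratio_upper:
  fixes V W X :: "'x \<Rightarrow> real"
  assumes F: "F \<noteq> bot" and b: "0 < b"
    and X: "\<forall>\<^sub>F x in F. 0 \<le> X x \<and> V x * W x powr b \<le> X x"
    and nonneg: "\<forall>\<^sub>F x in F. 0 \<le> V x \<and> 0 \<le> W x"
    and meaningful: "quotient_meaningful (Limsup F (\<lambda>x. ereal (X x))) (Liminf F (\<lambda>x. ereal (V x)))"
  shows "Limsup F (\<lambda>x. ereal (W x))
      \<le> ereal_powr (Limsup F (\<lambda>x. ereal (X x)) / Liminf F (\<lambda>x. ereal (V x))) (1 / b)"
    (is "?D \<le> ereal_powr (?X / ?V) _")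
proof (rule ccontr)
  assume "\<not> ?thesis"
  then have "ereal_powr (?X / ?V) (1 / b) < ?D" by simp
  from ereal_dense2[OF this] obtain d
    where d: "ereal_powr (?X / ?V) (1 / b) < ereal d" "ereal d < ?D" by blast
  have X0: "\<forall>\<^sub>F x in F. 0 \<le> ereal (X x)" using X by eventually_elim simp
  have V0: "\<forall>\<^sub>F x in F. 0 \<le> ereal (V x)" using nonneg by eventually_elim simp
  have nn: "0 \<le> ?X" "0 \<le> ?V" by (rule le_Limsup[OF F X0], rule Liminf_bounded[OF V0])
  then have "0 \<le> ?X / ?V" by (rule zero_le_divide_ereal)
  then have quot: "?X / ?V < ereal (d powr b)" using d(1) b by (intro less_powr_of_ereal_powr_less)
  have "0 \<le> ereal_powr (?X / ?V) (1 / b)" by (simp add: ereal_powr_def)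
  from le_less_trans[OF this d(1)] have "0 < d" by simp
  \<comment> \<open>Clearing the denominator uses \<open>quotient_meaningful\<close>:
    \<open>ereal\<close> evaluates 0/0 and \<infinity>/\<infinity> to 0, which would satisfy the
    quotient bound but not this inequality.\<close>
  have "?X < ereal (d powr b) * ?V"
  proof (cases ?V)
    case (real w)
    show ?thesis
    proof (cases "w = 0")
      case True
      then have "0 < ?X" using real nn meaningful by (auto simp: quotient_meaningful_def less_le)
      with real True quot show ?thesis by (cases ?X) auto
    next
      case False
      with real nn have "0 < w" by auto
      with real quot show ?thesis by (cases ?X) (auto simp: pos_divide_less_eq)
    qed
  next
    case PInf
    with meaningful have "?X < \<infinity>" by (auto simp: quotient_meaningful_def)
    with PInf \<open>0 < d\<close> show ?thesis by simp
  qed (use nn in simp)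
  \<comment> \<open>A real number in the gap splits the inequality into separate eventual bounds on
    \<open>X\<close> and on \<open>V\<close>.\<close>
  from ereal_dense2[OF this] obtain x where x: "?X < ereal x" "ereal x < ereal (d powr b) * ?V"
    by blast
  have "0 < x" using le_less_trans[OF nn(1) x(1)] by simp
  have "ereal (x / d powr b) < ?V"
    using x(2) \<open>0 < d\<close> by (cases ?V) (auto simp: pos_divide_less_eq mult.commute)
  from less_LiminfD[OF this] Limsup_lessD[OF x(1)] X nonneg
  have "\<forall>\<^sub>F y in F. ereal (W y) \<le> ereal d"
  proof eventually_elim
    case (elim y)
    show ?case
    proof (rule ccontr)
      assume "\<not> ?thesis"
      then have "d powr b \<le> W y powr b" using b \<open>0 < d\<close> by (intro powr_mono2) auto
      then have "V y * d powr b \<le> V y * W y powr b" using elim by (intro mult_left_mono) auto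
      moreover have "x < V y * d powr b" using elim \<open>0 < d\<close> by (simp add: pos_divide_less_eq)
      ultimately show False using elim by simp
    qed
  qed
  from Limsup_bounded[OF this] d(2) show False by simp
qed

(* U, P and Q are the (m-1)-, (p-1)- and (q-1)-fold logarithms of the three functions being
   compared; their logarithms enter the orders, and powers of them the types. *)
locale growth_comparison =
  fixes F :: "'x filter" and U P Q :: "'x \<Rightarrow> real" and a b c r :: real
  assumes nontrivial: "F \<noteq> bot"
    and U_top: "filterlim U at_top F" and P_top: "filterlim P at_top F" and Q_top: "filterlim Q at_top F"
    and order_UQ: "Limsup F (\<lambda>x. ereal (ln (U x) / ln (Q x))) = ereal a"
    and order_UP: "Limsup F (\<lambda>x. ereal (ln (U x) / ln (P x))) = ereal b"
    and lower_order_UP: "Liminf F (\<lambda>x. ereal (ln (U x) / ln (P x))) = ereal c"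
    and order_PQ: "Limsup F (\<lambda>x. ereal (ln (P x) / ln (Q x))) = ereal r"
    and pos: "0 < b" "0 < c" "0 < r"
begin

text \<open>Beyond 1 the logarithms are positive and powers increase with the exponent.\<close>

lemma large: "\<forall>\<^sub>F x in F. 1 < U x \<and> 1 < P x \<and> 1 < Q x"
  using U_top P_top Q_top by (simp add: filterlim_at_top_dense eventually_conj_iff)

text \<open>The ratio ln U / ln Q factors through ln P, so the product rules for limits
  apply.\<close>

lemma order_bounds: "a \<le> b * r" "c * r \<le> a"
proof -
  have eq: "\<forall>\<^sub>F x in F. ln (U x) / ln (Q x) = ln (U x) / ln (P x) * (ln (P x) / ln (Q x))"
    using large
  proof eventually_elim
    case (elim x)
    then have "ln (P x) \<noteq> 0" by simp
    then show ?case by simp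
  qed
  have nn: "\<forall>\<^sub>F x in F. 0 \<le> ln (P x) / ln (Q x)"
    using large by eventually_elim simp
  show "a \<le> b * r"
    by (rule Limsup_mult_upper[OF nontrivial _ nn order_UP _ order_PQ _ order_UQ])
      (use eq pos in \<open>auto elim: eventually_mono\<close>)
  show "c * r \<le> a"
    by (rule Limsup_mult_lower[OF nontrivial _ nn lower_order_UP _ order_PQ _ order_UQ])
      (use eq pos in \<open>auto elim: eventually_mono\<close>)
qed

text \<open>The powers of \<open>P\<close> cancel in (U / P^c) (P / Q^r)^c = U / Q^(c r), and c r
  \<le> a with Q > 1 makes this at least U / Q^a.\<close>

lemma type_lower_bounds:
  shows "ereal_powr (Limsup F (\<lambda>x. ereal (U x / Q x powr a)) / Limsup F (\<lambda>x. ereal (U x / P x powr c)))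
      (1 / c) \<le> Limsup F (\<lambda>x. ereal (P x / Q x powr r))"
    and "ereal_powr (Liminf F (\<lambda>x. ereal (U x / Q x powr a)) / Liminf F (\<lambda>x. ereal (U x / P x powr c)))
      (1 / c) \<le> Limsup F (\<lambda>x. ereal (P x / Q x powr r))"
proof -
  have 1: "\<forall>\<^sub>F x in F. 0 \<le> U x / Q x powr a \<and>
      U x / Q x powr a \<le> U x / P x powr c * (P x / Q x powr r) powr c"
    using large
  proof eventually_elim
    case (elim x)
    have "U x / P x powr c * (P x / Q x powr r) powr c = U x / Q x powr (c * r)"
      using elim by (simp add: powr_divide powr_powr mult.commute)
    moreover have "Q x powr (c * r) \<le> Q x powr a"
      using elim order_bounds by (intro powr_mono) auto
    ultimately show ?case using elim by (simp add: frac_le)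
  qed
  have 2: "\<forall>\<^sub>F x in F. 0 \<le> U x / P x powr c \<and> 0 \<le> P x / Q x powr r"
    using large by eventually_elim simp
  show "ereal_powr (Limsup F (\<lambda>x. ereal (U x / Q x powr a)) / Limsup F (\<lambda>x. ereal (U x / P x powr c)))
      (1 / c) \<le> Limsup F (\<lambda>x. ereal (P x / Q x powr r))"
    by (rule powr_ratio_lower[OF nontrivial pos(2) 1 2])
  show "ereal_powr (Liminf F (\<lambda>x. ereal (U x / Q x powr a)) / Liminf F (\<lambda>x. ereal (U x / P x powr c)))
      (1 / c) \<le> Limsup F (\<lambda>x. ereal (P x / Q x powr r))"
    by (rule powr_ratio_lower[OF nontrivial pos(2) 1 2])
qed

text \<open>The same cancellation with b in place of c; now a \<le> b r reverses the
  comparison.\<close>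

lemma type_upper_bound:
  assumes "quotient_meaningful (Limsup F (\<lambda>x. ereal (U x / Q x powr a)))
      (Liminf F (\<lambda>x. ereal (U x / P x powr b)))"
  shows "Limsup F (\<lambda>x. ereal (P x / Q x powr r)) \<le> ereal_powr
      (Limsup F (\<lambda>x. ereal (U x / Q x powr a)) / Liminf F (\<lambda>x. ereal (U x / P x powr b))) (1 / b)"
proof (rule powr_ratio_upper[OF nontrivial pos(1) _ _ assms])
  show "\<forall>\<^sub>F x in F. 0 \<le> U x / Q x powr a \<and>
      U x / P x powr b * (P x / Q x powr r) powr b \<le> U x / Q x powr a"
    using large
  proof eventually_elim
    case (elim x)
    have "U x / P x powr b * (P x / Q x powr r) powr b = U x / Q x powr (b * r)"
      using elim by (simp add: powr_divide powr_powr mult.commute)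
    moreover have "Q x powr a \<le> Q x powr (b * r)"
      using elim order_bounds by (intro powr_mono) auto
    ultimately show ?case using elim by (simp add: frac_le)
  qed
  show "\<forall>\<^sub>F x in F. 0 \<le> U x / P x powr b \<and> 0 \<le> P x / Q x powr r"
    using large by eventually_elim simp
qed

end

section \<open>The bounds for the relative type\<close>

theorem theorem2:
  fixes f :: "complex \<Rightarrow> 'a::complex_banach"
    and g :: "complex \<Rightarrow> 'b::complex_banach"
    and h :: "complex \<Rightarrow> 'c::complex_banach"
    and p q m :: int
  assumes "p \<ge> 0" "q \<ge> 0" "m \<ge> 0"
    and "entire_vvds f" "entire_vvds g" "entire_vvds h"
    and "has_rel_index_pair h m q f"
    and "has_rel_index_pair h m p g"
    and "0 < rel_order h m q f" "rel_order h m q f < \<infinity>"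
    and "0 < rel_order h m p g" "rel_order h m p g < \<infinity>"
    and "0 < rel_lower_order h m p g" "rel_lower_order h m p g < \<infinity>"
    and "0 < rel_order g p q f" "rel_order g p q f < \<infinity>"
    and "quotient_meaningful (rel_lower_type h m q f) (rel_weak_type h m p g)"
    and "quotient_meaningful (rel_type h m q f) (rel_weak_type_indicator h m p g)"
    and "quotient_meaningful (rel_type h m q f) (rel_lower_type h m p g)"
  shows "max (ereal_powr (rel_lower_type h m q f / rel_weak_type h m p g)
                (1 / real_of_ereal (rel_lower_order h m p g)))
             (ereal_powr (rel_type h m q f / rel_weak_type_indicator h m p g)
                (1 / real_of_ereal (rel_lower_order h m p g)))
           \<le> rel_type g p q f
       \<and> rel_type g p q f
           \<le> ereal_powr (rel_type h m q f / rel_lower_type h m p g)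
                (1 / real_of_ereal (rel_order h m p g))"
proof -
  have real: "\<exists>y. x = ereal y \<and> 0 < y" if "0 < x" "x < \<infinity>" for x :: ereal
    using that by (cases x) auto
  obtain a where a: "rel_order h m q f = ereal a"
    using real[OF assms(9,10)] by blast
  obtain b where b: "rel_order h m p g = ereal b" "0 < b"
    using real[OF assms(11,12)] by blast
  obtain c where c: "rel_lower_order h m p g = ereal c" "0 < c"
    using real[OF assms(13,14)] by blast
  obtain r where r: "rel_order g p q f = ereal r" "0 < r"
    using real[OF assms(15,16)] by blast
  \<comment> \<open>The indices are lowered by one, as in the types; index -1, meaning
    \<open>exp\<close>, occurs when \<open>m\<close>, \<open>p\<close> or \<open>q\<close> is
    0.\<close>
  define U where "U \<sigma> = iter_log (m - 1) (rel_growth h f \<sigma>)" for \<sigma>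
  define P where "P \<sigma> = iter_log (p - 1) (rel_growth g f \<sigma>)" for \<sigma>
  define Q where "Q \<sigma> = iter_log (q - 1) \<sigma>" for \<sigma>
  note subst = Limsup_rel_growth_subst[OF assms(4,5)] Liminf_rel_growth_subst[OF assms(4,5)]
  note log = iter_log_eq_ln[OF assms(1)] iter_log_eq_ln[OF assms(2)] iter_log_eq_ln[OF assms(3)]
  interpret growth_comparison at_top U P Q a b c r
  proof
    show "filterlim U at_top at_top" "filterlim P at_top at_top" "filterlim Q at_top at_top"
      unfolding U_def[abs_def] P_def[abs_def] Q_def[abs_def]
      by (intro filterlim_compose[OF filterlim_iter_log] filterlim_rel_growth assms filterlim_ident)+
    show "Limsup at_top (\<lambda>x. ereal (ln (U x) / ln (Q x))) = ereal a"
      using a unfolding rel_order_def log U_def Q_def .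
    show "Limsup at_top (\<lambda>x. ereal (ln (P x) / ln (Q x))) = ereal r"
      using r unfolding rel_order_def log P_def Q_def by simp
    show "Limsup at_top (\<lambda>x. ereal (ln (U x) / ln (P x))) = ereal b"
      using b subst(1)[of "\<lambda>u x. ereal (iter_log m u / iter_log p x)" h]
      unfolding rel_order_def log U_def P_def by simp
    show "Liminf at_top (\<lambda>x. ereal (ln (U x) / ln (P x))) = ereal c"
      using c subst(2)[of "\<lambda>u x. ereal (iter_log m u / iter_log p x)" h]
      unfolding rel_lower_order_def log U_def P_def by simp
  qed (use b c r in auto)
  have types:
    "rel_type h m q f = Limsup at_top (\<lambda>x. ereal (U x / Q x powr a))"
    "rel_lower_type h m q f = Liminf at_top (\<lambda>x. ereal (U x / Q x powr a))"
    "rel_type g p q f = Limsup at_top (\<lambda>x. ereal (P x / Q x powr r))"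
    by (simp_all add: rel_type_def rel_lower_type_def type_ratio_def[abs_def] a r U_def P_def Q_def)
  \<comment> \<open>The types of \<open>g\<close> are limits in the argument of
    \<open>max_modulus g\<close>; the substitution rewrites them in \<sigma>, the variable of the
    types of \<open>f\<close>.\<close>
  have types_g:
    "rel_weak_type h m p g = Liminf at_top (\<lambda>x. ereal (U x / P x powr c))"
    "rel_weak_type_indicator h m p g = Limsup at_top (\<lambda>x. ereal (U x / P x powr c))"
    "rel_lower_type h m p g = Liminf at_top (\<lambda>x. ereal (U x / P x powr b))"
    using subst(1)[of "\<lambda>u x. ereal (iter_log (m - 1) u / iter_log (p - 1) x powr c)" h]
      subst(2)[of "\<lambda>u x. ereal (iter_log (m - 1) u / iter_log (p - 1) x powr c)" h]
      subst(2)[of "\<lambda>u x. ereal (iter_log (m - 1) u / iter_log (p - 1) x powr b)" h]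
    by (simp_all add: rel_weak_type_def rel_weak_type_indicator_def rel_lower_type_def
        type_ratio_def[abs_def] b c U_def P_def)
  show ?thesis
    using type_lower_bounds type_upper_bound assms(19)
    by (simp add: types types_g b c)
qed

end
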